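(* For a pattern $\tau$ let $A_\tau(x)=\sum_{n\ge0}|\mathfrak D^1_{2n}(1342,1423,\tau)|\,x^n$. Let $\ell\ge 2$, let $\tau'\in\mathfrak S_{\ell-1}$ be any pattern that is not decreasing-decomposable, and let $\tau=\ell\tau'\in\mathfrak S_\ell$ with $\tau_\ell\ne\ell-1$. Then \[ A_\tau(x)=\frac{1}{1+x-2xA_{\tau'}(x)}. \]
   Context: A permutation $\sigma\in\mathfrak S_N$ contains a pattern $\tau\in\mathfrak S_k$ if there are positions $i_1<\dots<i_k$ such that $(\sigma(i_1),\dots,\sigma(i_k))$ is order-isomorphic to $\tau$; otherwise $\sigma$ avoids $\tau$. A Dumont permutation of the first kind is a permutation $\pi\in\mathfrak S_{2n}$ such that for every $i=1,\dots,2n$: if $\pi(i)$ is even then $i<2n$ and $\pi(i)>\pi(i+1)$; if $\pi(i)$ is odd then $i=2n$ or $\pi(i)<\pi(i+1)$. $\mathfrak D^1_{2n}(T)$ denotes the set of Dumont permutations of the first kind of length $2n$ avoiding all listed patterns $T$ (for $n=0$ the only Dumont permutation is the empty one). $\ell\tau'$ denotes the letter $\ell$ followed by the word $\tau'$ in one-line notation; $\tau_\ell$ is the last letter of $\tau$. A permutation $\tau$ is decreasing-decomposable if $\tau=\tau'\tau''$ for nonempty words $\tau',\tau''$ such that each entry of $\tau'$ is bigger than each entry of $\tau''$. Identities are of formal power series in $x$. *)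

theory Defs
  imports
    "HOL-Combinatorics.Multiset_Permutations"
    "HOL-Computational_Algebra.Formal_Power_Series"
begin

(* A permutation of {1..N} is represented by its one-line notation, a list in
   permutations_of_set {1..N}. List positions start at 0, so the value at the
   1-based position i is the list entry with index i - 1. *)

definition contains_pattern :: "nat list \<Rightarrow> nat list \<Rightarrow> bool" where
  "contains_pattern \<sigma> \<tau> \<longleftrightarrow>
     (\<exists>i :: nat \<Rightarrow> nat.
        strict_mono_on {..<length \<tau>} i \<and>
        (\<forall>a<length \<tau>. i a < length \<sigma>) \<and>
        (\<forall>a<length \<tau>. \<forall>b<length \<tau>. \<sigma> ! i a < \<sigma> ! i b \<longleftrightarrow> \<tau> ! a < \<tau> ! b))"

abbreviation avoids_pattern :: "nat list \<Rightarrow> nat list \<Rightarrow> bool" where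
  "avoids_pattern \<sigma> \<tau> \<equiv> \<not> contains_pattern \<sigma> \<tau>"

definition dumont1 :: "nat \<Rightarrow> nat list set" where
  "dumont1 n =
     {\<pi> \<in> permutations_of_set {1..2 * n}.
        \<forall>i\<in>{1..2 * n}.
          (even (\<pi> ! (i - 1)) \<longrightarrow> i < 2 * n \<and> \<pi> ! (i - 1) > \<pi> ! i) \<and>
          (odd (\<pi> ! (i - 1)) \<longrightarrow> i = 2 * n \<or> \<pi> ! (i - 1) < \<pi> ! i)}"

definition dumont1_avoiding :: "nat \<Rightarrow> nat list set \<Rightarrow> nat list set" where
  "dumont1_avoiding n T = {\<pi> \<in> dumont1 n. \<forall>\<tau>\<in>T. avoids_pattern \<pi> \<tau>}"

(* Rational coefficients, so that power series division is available. *)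
definition A_gf :: "nat list \<Rightarrow> rat fps" where
  "A_gf \<tau> =
     Abs_fps (\<lambda>n. of_nat (card (dumont1_avoiding n {[1, 3, 4, 2], [1, 4, 2, 3], \<tau>})))"

definition decreasing_decomposable :: "nat list \<Rightarrow> bool" where
  "decreasing_decomposable \<tau> \<longleftrightarrow>
     (\<exists>u v. \<tau> = u @ v \<and> u \<noteq> [] \<and> v \<noteq> [] \<and> (\<forall>x\<in>set u. \<forall>y\<in>set v. x > y))"

end

theory Submission
  imports Defs "HOL-Library.Sublist"
begin

text \<open>
  In a Dumont permutation of length \<open>2 * m + 2\<close> the odd letter \<open>N = 2 * m + 1\<close> is either last or
  immediately followed by the maximum \<open>M = 2 * m + 2\<close>. Hence the permutation is \<open>u M v N\<close> or
  \<open>u N M v\<close>, and avoiding 1423 respectively 1342 forces every letter of \<open>u\<close> to exceed every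
  letter of \<open>v\<close>. The Dumont condition then makes the length of \<open>v\<close> even, so \<open>u\<close> is a Dumont
  permutation shifted by an even number, \<open>v\<close> is a Dumont permutation, and \<open>v\<close> is nonempty in the
  second form because \<open>M\<close> cannot be last. Since \<open>M\<close> can play the role of the leading \<open>l\<close>
  in front of \<open>v\<close>, the whole word avoids \<open>l \<tau>'\<close> iff \<open>u\<close> avoids \<open>l \<tau>'\<close> and \<open>v\<close> avoids
  \<open>\<tau>'\<close>. Counting both forms gives
  \<open>a (m + 1) + a m = 2 * (\<Sum>j\<le>m. a (m - j) * a' j)\<close>.
\<close>

section \<open>Pattern containment through subsequences\<close>

text \<open>Comparing zipped pairs instead of positions makes the relation compatible with
  concatenation: cutting a word in two only cuts the set of pairs in two.\<close>

definition order_iso :: "nat list \<Rightarrow> nat list \<Rightarrow> bool" where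
  "order_iso xs ys \<longleftrightarrow> length xs = length ys \<and>
     (\<forall>(a, b)\<in>set (zip xs ys). \<forall>(c, d)\<in>set (zip xs ys). a < c \<longleftrightarrow> b < d)"

lemma order_iso_nth:
  "order_iso xs ys \<longleftrightarrow> length xs = length ys \<and>
     (\<forall>a<length ys. \<forall>b<length ys. xs ! a < xs ! b \<longleftrightarrow> ys ! a < ys ! b)"
  unfolding order_iso_def set_zip by (auto; blast)

text \<open>Induction peels off the largest index: all smaller indices read from
  \<open>take (i k) xs\<close>, while the letter at \<open>i k\<close> is the head of
  \<open>drop (i k) xs\<close>.\<close>

lemma subseq_nth_strict_mono:
  assumes "strict_mono_on {..<k} i" "\<forall>a<k. i a < length xs"
  shows "subseq (map (\<lambda>a. xs ! i a) [0..<k]) xs"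
  using assms
proof (induction k arbitrary: xs)
  case 0
  then show ?case by simp
next
  case (Suc k)
  have lt: "i a < i k" if "a < k" for a
    using Suc.prems(1) that by (auto simp: strict_mono_on_def)
  have ik: "i k < length xs" using Suc.prems by auto
  have "subseq (map (\<lambda>a. take (i k) xs ! i a) [0..<k]) (take (i k) xs)"
    using Suc.prems lt ik by (intro Suc.IH) (auto simp: strict_mono_on_def)
  moreover have "map (\<lambda>a. take (i k) xs ! i a) [0..<k] = map (\<lambda>a. xs ! i a) [0..<k]"
    using lt by auto
  ultimately have "subseq (map (\<lambda>a. xs ! i a) [0..<k] @ [xs ! i k]) (take (i k) xs @ drop (i k) xs)"
    using ik by (intro list_emb_append_mono) (auto simp: Cons_nth_drop_Suc [symmetric])
  then show ?case by simp
qed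

lemma subseq_strict_mono_nth:
  assumes "subseq xs ys"
  shows "\<exists>i. strict_mono_on {..<length xs} i \<and> (\<forall>a<length xs. i a < length ys \<and> ys ! i a = xs ! a)"
  using assms
proof (induction rule: list_emb.induct)
  case (list_emb_Nil ys)
  then show ?case by (auto simp: strict_mono_on_def)
next
  case (list_emb_Cons xs ys y)
  then obtain i where i: "strict_mono_on {..<length xs} i"
    "\<forall>a<length xs. i a < length ys \<and> ys ! i a = xs ! a" by blast
  show ?case
    by (rule exI [of _ "Suc \<circ> i"]) (use i in \<open>auto simp: strict_mono_on_def\<close>)
next
  case (list_emb_Cons2 x y xs ys)
  then obtain i where i: "strict_mono_on {..<length xs} i"
    "\<forall>a<length xs. i a < length ys \<and> ys ! i a = xs ! a" by blast
  \<comment> \<open>Both heads are matched, so position 0 goes to 0 and the old index map moves up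
    by one on both sides.\<close>
  show ?case
    by (rule exI [of _ "case_nat 0 (Suc \<circ> i)"])
      (use i list_emb_Cons2 in \<open>auto simp: strict_mono_on_def nth_Cons split: nat.split\<close>)
qed

text \<open>Trading index maps for subsequences lets an occurrence in \<open>u @ v\<close> be cut
  into its parts in \<open>u\<close> and in \<open>v\<close>.\<close>

lemma contains_pattern_iff_subseq:
  "contains_pattern \<sigma> \<tau> \<longleftrightarrow> (\<exists>xs. subseq xs \<sigma> \<and> order_iso xs \<tau>)"
proof
  assume "contains_pattern \<sigma> \<tau>"
  then obtain i where i: "strict_mono_on {..<length \<tau>} i" "\<forall>a<length \<tau>. i a < length \<sigma>"
    "\<forall>a<length \<tau>. \<forall>b<length \<tau>. \<sigma> ! i a < \<sigma> ! i b \<longleftrightarrow> \<tau> ! a < \<tau> ! b"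
    unfolding contains_pattern_def by blast
  then show "\<exists>xs. subseq xs \<sigma> \<and> order_iso xs \<tau>"
    by (intro exI [of _ "map (\<lambda>a. \<sigma> ! i a) [0..<length \<tau>]"] conjI subseq_nth_strict_mono)
      (auto simp: order_iso_nth)
next
  assume "\<exists>xs. subseq xs \<sigma> \<and> order_iso xs \<tau>"
  then obtain xs where xs: "subseq xs \<sigma>" "order_iso xs \<tau>" by blast
  then obtain i where "strict_mono_on {..<length xs} i"
    "\<forall>a<length xs. i a < length \<sigma> \<and> \<sigma> ! i a = xs ! a"
    using subseq_strict_mono_nth by blast
  with xs(2) show "contains_pattern \<sigma> \<tau>"
    unfolding contains_pattern_def order_iso_nth by (intro exI [of _ i]) auto
qed

lemma subseq_set_subset: "subseq xs ys \<Longrightarrow> set xs \<subseteq> set ys"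
  by (auto dest: list_emb_set)

lemma contains_pattern_subseq:
  "contains_pattern \<rho> \<tau> \<Longrightarrow> subseq \<rho> \<sigma> \<Longrightarrow> contains_pattern \<sigma> \<tau>"
  unfolding contains_pattern_iff_subseq by (meson subseq_order.order_trans)

lemma not_contains_pattern_Nil: "\<tau> \<noteq> [] \<Longrightarrow> \<not> contains_pattern [] \<tau>"
  by (auto simp: contains_pattern_def)

lemma contains_pattern_shift [simp]:
  "contains_pattern (map (\<lambda>x. x + k) \<sigma>) \<tau> \<longleftrightarrow> contains_pattern \<sigma> \<tau>"
  unfolding contains_pattern_def by (simp cong: conj_cong)

section \<open>Order isomorphism and cuts of words\<close>

text \<open>The last fact retains the comparisons across the cut, in both directions; the
  isomorphisms of the two parts alone would lose them.\<close>

lemma order_iso_append: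
  assumes "order_iso (xs @ ys) t"
  obtains us vs where "t = us @ vs" "order_iso xs us" "order_iso ys vs"
    "\<forall>(a, b)\<in>set (zip xs us). \<forall>(c, d)\<in>set (zip ys vs). (a < c \<longleftrightarrow> b < d) \<and> (c < a \<longleftrightarrow> d < b)"
proof
  let ?us = "take (length xs) t" and ?vs = "drop (length xs) t"
  have len: "length t = length xs + length ys" using assms by (simp add: order_iso_def)
  show "t = ?us @ ?vs" by simp
  have z: "set (zip (xs @ ys) t) = set (zip xs ?us) \<union> set (zip ys ?vs)"
    by (subst zip_append1) (simp add: Un_commute)
  show "order_iso xs ?us" "order_iso ys ?vs"
    using assms len unfolding order_iso_def z by (simp_all add: ball_Un split_beta)
  show "\<forall>(a, b)\<in>set (zip xs ?us). \<forall>(c, d)\<in>set (zip ys ?vs). (a < c \<longleftrightarrow> b < d) \<and> (c < a \<longleftrightarrow> d < b)"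
    using assms unfolding order_iso_def z by (simp add: ball_Un split_beta)
qed

lemma order_iso_ConsE:
  assumes "order_iso xs (t # ts)"
  obtains x zs where "xs = x # zs" "order_iso zs ts"
proof (cases xs)
  case (Cons x zs)
  with assms have "order_iso zs ts" by (auto simp: order_iso_def)
  with Cons that show ?thesis by blast
qed (use assms in \<open>simp add: order_iso_def\<close>)

lemma order_iso_Nil [simp]: "order_iso [] t \<longleftrightarrow> t = []" "order_iso xs [] \<longleftrightarrow> xs = []"
  by (auto simp: order_iso_def)

lemma zip_set2: "length xs = length ys \<Longrightarrow> y \<in> set ys \<Longrightarrow> \<exists>x\<in>set xs. (x, y) \<in> set (zip xs ys)"
  by (metis in_set_impl_in_set_zip2 set_zip_leftD)

text \<open>A cut of \<open>xs @ ys\<close> with all letters before it above all letters after it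
  carries over to \<open>t\<close>, and with both parts nonempty it would be a decreasing
  decomposition of \<open>t\<close>.\<close>

lemma order_iso_indecomposable:
  assumes "order_iso (xs @ ys) t" "\<not> decreasing_decomposable t"
    and gt: "\<forall>x\<in>set xs. \<forall>y\<in>set ys. y < x"
  shows "xs = [] \<or> ys = []"
proof -
  obtain us vs where t: "t = us @ vs" and iso: "order_iso xs us" "order_iso ys vs" and
    cross: "\<forall>(a, b)\<in>set (zip xs us). \<forall>(c, d)\<in>set (zip ys vs). (a < c \<longleftrightarrow> b < d) \<and> (c < a \<longleftrightarrow> d < b)"
    using order_iso_append [OF assms(1)] .
  have len: "length xs = length us" "length ys = length vs" using iso by (auto simp: order_iso_def)
  have "d < b" if b: "b \<in> set us" and d: "d \<in> set vs" for b d
  proof -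
    obtain a c where "(a, b) \<in> set (zip xs us)" "(c, d) \<in> set (zip ys vs)" "a \<in> set xs" "c \<in> set ys"
      using zip_set2 [OF len(1) b] zip_set2 [OF len(2) d] by blast
    then have "(c < a \<longleftrightarrow> d < b) \<and> c < a" using cross gt by fast
    then show ?thesis by blast
  qed
  then have "us = [] \<or> vs = []"
    using assms(2) t unfolding decreasing_decomposable_def by blast
  then show ?thesis using len by auto
qed

text \<open>The parts of an occurrence in \<open>u\<close> and in \<open>v\<close> inherit the order
  of the blocks, so one of them is empty.\<close>

lemma contains_pattern_append_indecomposable:
  assumes "\<not> decreasing_decomposable t" "\<forall>x\<in>set u. \<forall>y\<in>set v. y < x"
  shows "contains_pattern (u @ v) t \<longleftrightarrow> contains_pattern u t \<or> contains_pattern v t"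
proof
  assume "contains_pattern (u @ v) t"
  then obtain zs where "subseq zs (u @ v)" "order_iso zs t"
    unfolding contains_pattern_iff_subseq by blast
  then obtain xs ys where xy: "order_iso (xs @ ys) t" "subseq xs u" "subseq ys v"
    by (auto simp: subseq_append_iff)
  moreover have "\<forall>x\<in>set xs. \<forall>y\<in>set ys. y < x"
    using assms(2) xy(2,3) [THEN subseq_set_subset] by blast
  ultimately have "xs = [] \<or> ys = []" using order_iso_indecomposable assms(1) by blast
  with xy show "contains_pattern u t \<or> contains_pattern v t"
    unfolding contains_pattern_iff_subseq by auto
qed (auto intro: contains_pattern_subseq list_emb_append2)

text \<open>Once the leading letter of an occurrence is set aside, the rest is an occurrence of
  \<open>t\<close> and cannot meet both blocks. Conversely, a letter of \<open>u\<close> above all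
  of \<open>v\<close> can play \<open>l\<close> in front of any occurrence of \<open>t\<close> in
  \<open>v\<close>.\<close>

lemma contains_pattern_append_Cons:
  assumes "\<not> decreasing_decomposable t" "\<forall>x\<in>set u. \<forall>y\<in>set v. y < x"
    and "\<forall>x\<in>set t. x < l" "\<exists>x\<in>set u. \<forall>y\<in>set v. y < x"
  shows "contains_pattern (u @ v) (l # t) \<longleftrightarrow> contains_pattern u (l # t) \<or> contains_pattern v t"
proof
  assume "contains_pattern (u @ v) (l # t)"
  then obtain zs where "subseq zs (u @ v)" "order_iso zs (l # t)"
    unfolding contains_pattern_iff_subseq by blast
  then obtain xs ys where xy: "order_iso (xs @ ys) (l # t)" "subseq xs u" "subseq ys v"
    by (auto simp: subseq_append_iff)
  show "contains_pattern u (l # t) \<or> contains_pattern v t"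
  proof (cases xs)
    \<comment> \<open>The whole occurrence lies in \<open>v\<close>; dropping its leading letter
      leaves an occurrence of \<open>t\<close>.\<close>
    case Nil
    then obtain y ws where "ys = y # ws" "order_iso ws t"
      using xy order_iso_ConsE by (metis append_Nil)
    then have "subseq ws v" using xy(3) by (auto dest: subseq_Cons')
    with \<open>order_iso ws t\<close> show ?thesis unfolding contains_pattern_iff_subseq by blast
  next
    case (Cons x ws)
    then have iso: "order_iso (ws @ ys) t"
      using xy(1) by (auto elim: order_iso_ConsE)
    have "set ws \<subseteq> set u" "set ys \<subseteq> set v"
      using xy Cons by (auto dest!: subseq_set_subset)
    then have "ws = [] \<or> ys = []"
      using order_iso_indecomposable [OF iso assms(1)] assms(2) by blast
    then show ?thesis
    proof
      assume "ws = []"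
      then show ?thesis using iso xy unfolding contains_pattern_iff_subseq by auto
    next
      assume "ys = []"
      then show ?thesis using xy unfolding contains_pattern_iff_subseq by auto
    qed
  qed
next
  assume "contains_pattern u (l # t) \<or> contains_pattern v t"
  then show "contains_pattern (u @ v) (l # t)"
  proof
    assume "contains_pattern u (l # t)"
    then show ?thesis by (auto intro: contains_pattern_subseq)
  next
    assume "contains_pattern v t"
    then obtain ys where ys: "subseq ys v" "order_iso ys t"
      unfolding contains_pattern_iff_subseq by blast
    obtain x where x: "x \<in> set u" "\<forall>y\<in>set v. y < x" using assms(4) by blast
    have "subseq ([x] @ ys) (u @ v)"
      using ys x by (intro list_emb_append_mono) (auto simp: subseq_singleton_left)
    moreover have "order_iso (x # ys) (l # t)"
    proof -
      have *: "a < x \<and> b < l" if "(a, b) \<in> set (zip ys t)" for a b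
        using set_zip_leftD [OF that] set_zip_rightD [OF that] x(2) assms(3) subseq_set_subset [OF ys(1)]
        by blast
      have "length (x # ys) = length (l # t)" using ys(2) by (simp add: order_iso_def)
      moreover have "a < c \<longleftrightarrow> b < d"
        if ab: "(a, b) \<in> set (zip (x # ys) (l # t))" and cd: "(c, d) \<in> set (zip (x # ys) (l # t))" for a b c d
      proof -
        have iso: "a < c \<longleftrightarrow> b < d" if "(a, b) \<in> set (zip ys t)" "(c, d) \<in> set (zip ys t)"
          using ys(2) that unfolding order_iso_def by fast
        consider "a = x" "b = l" | "(a, b) \<in> set (zip ys t)" using ab by auto
        then show ?thesis
        proof cases
          case 1
          consider "c = x" "d = l" | "(c, d) \<in> set (zip ys t)" using cd by auto
          then show ?thesis using 1 * [of c d] by cases auto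
        next
          case 2
          consider "c = x" "d = l" | "(c, d) \<in> set (zip ys t)" using cd by auto
          then show ?thesis using 2 * [of a b] iso by cases auto
        qed
      qed
      ultimately show ?thesis unfolding order_iso_def by blast
    qed
    ultimately show ?thesis unfolding contains_pattern_iff_subseq by auto
  qed
qed

section \<open>Letters appended at the end of a word\<close>

text \<open>An occurrence that uses the appended \<open>N\<close> must let it play the last letter
  \<open>b\<close> of \<open>t\<close>. The final clause then says which earlier letters of the
  occurrence lie above or below \<open>N\<close>.\<close>

lemma contains_pattern_snocE:
  assumes "contains_pattern (w @ [N]) t"
  obtains "contains_pattern w t"
    | xs us b where "subseq xs w" "t = us @ [b]" "order_iso (xs @ [N]) t" "length xs = length us"
      "\<And>y. y \<in> set us \<Longrightarrow> \<exists>x\<in>set xs. (x, y) \<in> set (zip xs us) \<and> (x < N \<longleftrightarrow> y < b) \<and> (N < x \<longleftrightarrow> b < y)"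
proof -
  obtain zs where "subseq zs (w @ [N])" "order_iso zs t"
    using assms unfolding contains_pattern_iff_subseq by blast
  then obtain xs ys where xy: "order_iso (xs @ ys) t" "subseq xs w" "subseq ys [N]"
    by (auto simp: subseq_append_iff)
  show ?thesis
  proof (cases "ys = []")
    case True
    with xy that(1) show ?thesis unfolding contains_pattern_iff_subseq by auto
  next
    case False
    with xy(3) have ys: "ys = [N]" by (cases ys) (auto split: if_splits)
    obtain us vs where t: "t = us @ vs" and iso: "order_iso xs us" "order_iso [N] vs" and
      cross: "\<forall>(a, b)\<in>set (zip xs us). \<forall>(c, d)\<in>set (zip [N] vs). (a < c \<longleftrightarrow> b < d) \<and> (c < a \<longleftrightarrow> d < b)"
      using order_iso_append [OF xy(1) [unfolded ys]] .
    obtain b where b: "vs = [b]" using iso(2) by (cases vs) (auto simp: order_iso_def)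
    have len: "length xs = length us" using iso(1) by (simp add: order_iso_def)
    show ?thesis
    proof (rule that(2) [OF xy(2)])
      show "t = us @ [b]" "order_iso (xs @ [N]) t" "length xs = length us"
        using t b len xy(1) ys by auto
      fix y assume "y \<in> set us"
      with zip_set2 [OF len] obtain x where "x \<in> set xs" "(x, y) \<in> set (zip xs us)" by blast
      with cross b
      show "\<exists>x\<in>set xs. (x, y) \<in> set (zip xs us) \<and> (x < N \<longleftrightarrow> y < b) \<and> (N < x \<longleftrightarrow> b < y)" by auto
    qed
  qed
qed

text \<open>In an occurrence, \<open>N\<close> would play the last letter of \<open>t\<close>, but
  some letter of \<open>t\<close> is larger and nothing in \<open>w\<close> exceeds
  \<open>N\<close>.\<close>

lemma contains_pattern_snoc_max:
  assumes "\<exists>y\<in>set t. last t < y" "\<forall>x\<in>set w. x < N"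
  shows "contains_pattern (w @ [N]) t \<longleftrightarrow> contains_pattern w t"
proof
  assume "contains_pattern (w @ [N]) t"
  then show "contains_pattern w t"
  proof (cases rule: contains_pattern_snocE)
    case (2 xs us b)
    from assms(1) 2(2) obtain y where y: "y \<in> set us" "b < y" by auto
    from 2(5) [OF y(1)] y obtain x where "x \<in> set xs" "N < x" by auto
    moreover have "x < N" using calculation assms(2) 2(1) subseq_set_subset by blast
    ultimately show ?thesis by simp
  qed
qed (auto intro: contains_pattern_subseq)

text \<open>If \<open>N\<close> played the last letter of \<open>t\<close>, the letters playing
  \<open>y\<close> and \<open>z\<close> would both exceed \<open>N\<close>. The only value available
  for them is \<open>M\<close>, whereas \<open>y < z\<close> needs two distinct values.\<close>

lemma contains_pattern_snoc_second_max:
  assumes "y \<in> set t" "z \<in> set t" "y < z" "last t < y" "\<forall>x\<in>set w. x < N \<or> x = M"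
  shows "contains_pattern (w @ [N]) t \<longleftrightarrow> contains_pattern w t"
proof
  assume "contains_pattern (w @ [N]) t"
  then show "contains_pattern w t"
  proof (cases rule: contains_pattern_snocE)
    case (2 xs us b)
    have "y \<in> set us" "z \<in> set us" "b < y" "b < z" using assms 2(2) by auto
    with 2(5) obtain x x' where x: "x \<in> set xs" "x' \<in> set xs" "N < x" "N < x'"
      "(x, y) \<in> set (zip xs us)" "(x', z) \<in> set (zip xs us)" by metis
    then have "x = M" "x' = M" using assms(5) subseq_set_subset [OF 2(1)] by force+
    moreover have "x < x'"
    proof -
      have "(x, y) \<in> set (zip (xs @ [N]) t)" "(x', z) \<in> set (zip (xs @ [N]) t)"
        using x 2(2,4) by auto
      with 2(3) \<open>y < z\<close> show ?thesis unfolding order_iso_def by fast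
    qed
    ultimately show ?thesis by simp
  qed
qed (auto intro: contains_pattern_subseq)

text \<open>Since \<open>m\<close> occurs only once in the word, an embedding has to use that
  occurrence, and the letters on its two sides are confined to \<open>u\<close> and
  \<open>v\<close>.\<close>

lemma subseq_unique_middle:
  "subseq (a # m # zs) (u @ m # v) \<Longrightarrow> m \<notin> set u \<Longrightarrow> m \<notin> set v \<Longrightarrow> a \<in> set u \<and> set zs \<subseteq> set v"
proof (induction u arbitrary: a)
  case Nil
  then show ?case by (auto split: if_splits dest!: subseq_set_subset)
next
  case (Cons x u)
  show ?case
  proof (cases "a = x")
    case True
    with Cons.prems have s: "subseq (m # zs) (u @ m # v)" by auto
    \<comment> \<open>After \<open>a\<close> is matched, no letter of \<open>u\<close> can be
      matched with \<open>m\<close>, so the embedding skips the rest of \<open>u\<close>.\<close>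
    have "subseq zs v" using s Cons.prems(2)
    proof (induction u)
      case Nil then show ?case by auto
    next
      case (Cons c u) then show ?case by (auto split: if_splits)
    qed
    then show ?thesis using True by (auto dest: subseq_set_subset)
  next
    case False
    with Cons show ?thesis by auto
  qed
qed

text \<open>
  The pattern 1423 has a single letter above its last one, so \<open>contains_pattern_snoc_second_max\<close> does not apply and
  the order of the blocks is needed.
\<close>
lemma contains_1423_snoc:
  assumes "\<forall>x\<in>set u. \<forall>y\<in>set v. y < x" "\<forall>x\<in>set u \<union> set v. x < N" "N < M"
  shows "contains_pattern (u @ M # v @ [N]) [1, 4, 2, 3] \<longleftrightarrow> contains_pattern (u @ M # v) [1, 4, 2, 3]"
proof
  assume "contains_pattern (u @ M # v @ [N]) [1, 4, 2, 3]"
  then have "contains_pattern ((u @ M # v) @ [N]) [1, 4, 2, 3]" by simp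
  then show "contains_pattern (u @ M # v) [1, 4, 2, 3]"
  proof (cases rule: contains_pattern_snocE)
    case (2 xs us b)
    then have us: "us = [1, 4, 2]" "b = 3" by (auto simp: append_eq_Cons_conv)
    with 2(4) obtain x y z where xs: "xs = [x, y, z]"
      by (auto simp: length_Suc_conv)
    \<comment> \<open>The letters \<open>x\<close>, \<open>y\<close>, \<open>z\<close> play 1, 4, 2.
      As \<open>y\<close> exceeds \<open>N\<close>, it is \<open>M\<close>; then \<open>x\<close>
      lies in \<open>u\<close> and \<open>z\<close> in \<open>v\<close>, against
      \<open>x < z\<close>.\<close>
    have o: "x < z" "N < y" using 2(3) unfolding xs 2(2) us by (auto simp: order_iso_def)
    have "set xs \<subseteq> insert M (set u \<union> set v)" using subseq_set_subset [OF 2(1)] by auto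
    then have "y = M \<or> y \<in> set u \<union> set v" using xs by auto
    then have "y = M" using o(2) assms(2) less_asym by blast
    with 2(1) xs have "subseq (x # M # [z]) (u @ M # v)" by simp
    then have "x \<in> set u \<and> set [z] \<subseteq> set v"
      using assms(2,3) by (intro subseq_unique_middle) (blast dest: less_asym)+
    with o assms(1) show ?thesis by force
  qed
next
  show "contains_pattern (u @ M # v @ [N]) [1, 4, 2, 3]" if "contains_pattern (u @ M # v) [1, 4, 2, 3]"
    using contains_pattern_subseq [OF that]
      list_emb_prefix [OF subseq_order.order_refl, of "u @ M # v" "[N]"] by simp
qed


section \<open>A maximum between two blocks\<close>

text \<open>Attached to \<open>u\<close>, the letter \<open>M\<close> keeps the first block above
  \<open>v\<close>. Once the blocks are separated, \<open>M\<close> stands at the end of a word and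
  can be removed as its maximum.\<close>

lemma contains_pattern_middle_max:
  assumes "\<not> decreasing_decomposable t" "\<exists>y\<in>set t. last t < y"
    and "\<forall>x\<in>set u. \<forall>y\<in>set v. y < x" "\<forall>x\<in>set u \<union> set v. x < M"
  shows "contains_pattern (u @ M # v) t \<longleftrightarrow> contains_pattern u t \<or> contains_pattern v t"
proof -
  have "contains_pattern ((u @ [M]) @ v) t \<longleftrightarrow> contains_pattern (u @ [M]) t \<or> contains_pattern v t"
    using assms by (intro contains_pattern_append_indecomposable) auto
  then show ?thesis
    using contains_pattern_snoc_max [OF assms(2), of u M] assms(4) by simp
qed

text \<open>Here \<open>M\<close> is also the letter above all of \<open>v\<close> that can play
  \<open>l\<close>, even when \<open>u\<close> is empty.\<close>

lemma contains_pattern_middle_max_Cons: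
  assumes "\<not> decreasing_decomposable t" "t \<noteq> []" "\<forall>x\<in>set t. x < l"
    and "\<forall>x\<in>set u. \<forall>y\<in>set v. y < x" "\<forall>x\<in>set u \<union> set v. x < M"
  shows "contains_pattern (u @ M # v) (l # t) \<longleftrightarrow> contains_pattern u (l # t) \<or> contains_pattern v t"
proof -
  have "contains_pattern ((u @ [M]) @ v) (l # t) \<longleftrightarrow> contains_pattern (u @ [M]) (l # t) \<or> contains_pattern v t"
    using assms by (intro contains_pattern_append_Cons) auto
  moreover have "\<exists>y\<in>set (l # t). last (l # t) < y" using assms(2,3) by auto
  ultimately show ?thesis
    using contains_pattern_snoc_max [of "l # t" u M] assms(5) by simp
qed

text \<open>Serves for 1342 and 1423, which both begin with their smallest letter.\<close>

lemma not_decreasing_decomposable_Cons_min: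
  assumes "\<forall>y\<in>set t. x \<le> y"
  shows "\<not> decreasing_decomposable (x # t)"
proof
  assume "decreasing_decomposable (x # t)"
  then obtain u v where uv: "x # t = u @ v" "u \<noteq> []" "v \<noteq> []" "\<forall>a\<in>set u. \<forall>b\<in>set v. b < a"
    unfolding decreasing_decomposable_def by blast
  then obtain us where "u = x # us" "t = us @ v" by (cases u) auto
  then have "hd v \<in> set t" "hd v < x" using uv by auto
  then show False using assms by force
qed

section \<open>Dumont words and their blocks\<close>

text \<open>A condition on adjacent letters and on the last letter, free of any length or alphabet,
  so that it also applies to the blocks of a permutation.\<close>

definition dumont_word :: "nat list \<Rightarrow> bool" where
  "dumont_word xs \<longleftrightarrow>
     successively (\<lambda>a b. if even a then b < a else a < b) xs \<and> (xs \<noteq> [] \<longrightarrow> odd (last xs))"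

lemma dumont1_iff: "\<pi> \<in> dumont1 n \<longleftrightarrow> \<pi> \<in> permutations_of_set {1..2 * n} \<and> dumont_word \<pi>"
proof (cases "\<pi> \<in> permutations_of_set {1..2 * n}")
  case True
  then have len: "length \<pi> = 2 * n"
    using length_finite_permutations_of_set by fastforce
  have ends: "(\<forall>i\<in>{1..2 * n}. P (i - 1) i) \<longleftrightarrow> (\<forall>k. Suc k < 2 * n \<longrightarrow> P k (Suc k)) \<and> (n \<noteq> 0 \<longrightarrow> P (2 * n - 1) (2 * n))"
    for P :: "nat \<Rightarrow> nat \<Rightarrow> bool"
  proof -
    have "{1..2 * n} = Suc ` {..<2 * n}" by (simp add: image_Suc_lessThan)
    then have "(\<forall>i\<in>{1..2 * n}. P (i - 1) i) \<longleftrightarrow> (\<forall>k<2 * n. P k (Suc k))" by auto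
    moreover have "k < 2 * n \<longleftrightarrow> Suc k < 2 * n \<or> n \<noteq> 0 \<and> k = 2 * n - 1" for k by auto
    moreover have "n \<noteq> 0 \<Longrightarrow> Suc (2 * n - 1) = 2 * n" by simp
    ultimately show ?thesis by metis
  qed
  \<comment> \<open>At \<open>b = 2 * n\<close> the entry \<open>\<pi> ! b\<close> is out of range,
    but its value has no influence: the conjunct for even letters is false there and the one for odd
    letters true. This is exactly the demand that the last letter be odd.\<close>
  define P where "P = (\<lambda>a b. (even (\<pi> ! a) \<longrightarrow> b < 2 * n \<and> \<pi> ! a > \<pi> ! b) \<and>
    (odd (\<pi> ! a) \<longrightarrow> b = 2 * n \<or> \<pi> ! a < \<pi> ! b))"
  have "\<pi> \<in> dumont1 n \<longleftrightarrow> (\<forall>i\<in>{1..2 * n}. P (i - 1) i)"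
    using True by (simp add: dumont1_def P_def)
  also note ends
  also have "(\<forall>k. Suc k < 2 * n \<longrightarrow> P k (Suc k)) \<and> (n \<noteq> 0 \<longrightarrow> P (2 * n - 1) (2 * n)) \<longleftrightarrow> dumont_word \<pi>"
    using len unfolding dumont_word_def successively_conv_nth P_def
    by (cases "n = 0") (auto simp: last_conv_nth)
  finally show ?thesis using True by simp
qed (simp add: dumont1_def)

lemma dumont_word_Nil [simp]: "dumont_word []"
  by (simp add: dumont_word_def)

lemma dumont_word_shift [simp]: "dumont_word (map (\<lambda>x. x + 2 * k) xs) \<longleftrightarrow> dumont_word xs"
  by (auto simp: dumont_word_def successively_map last_map cong: successively_cong)

text \<open>An even letter cannot be last, and its successor is smaller. Hence the least letter of a
  Dumont word is odd.\<close>

lemma dumont_word_even_descends: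
  assumes "dumont_word xs" "x \<in> set xs" "even x"
  shows "\<exists>y\<in>set xs. y < x"
proof -
  obtain us vs where xs: "xs = us @ x # vs" using assms(2) by (auto dest: split_list)
  with assms have "vs \<noteq> []" by (auto simp: dumont_word_def)
  then obtain y ws where "vs = y # ws" by (cases vs) auto
  with assms xs show ?thesis by (auto simp: dumont_word_def successively_append_iff)
qed

text \<open>Passing from \<open>u\<close> to \<open>M\<close> and from \<open>v\<close> to
  \<open>N\<close> is an ascent, allowed precisely when the letter before it is odd. These are the
  end conditions of the blocks \<open>u\<close> and \<open>v\<close>.\<close>

lemma dumont_word_append_max_snoc:
  assumes "even M" "odd N" "N < M" "\<forall>x\<in>set u \<union> set v. x < N"
  shows "dumont_word (u @ M # v @ [N]) \<longleftrightarrow> dumont_word u \<and> dumont_word v"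
proof -
  define P where "P = (\<lambda>a b :: nat. if even a then b < a else a < b)"
  have word: "dumont_word xs \<longleftrightarrow> successively P xs \<and> (xs = [] \<or> odd (last xs))" for xs
    by (auto simp: dumont_word_def P_def)
  have "successively P (u @ [M] @ v @ [N]) \<longleftrightarrow> successively P u \<and> successively P v \<and>
      (u = [] \<or> P (last u) M) \<and> P M (hd (v @ [N])) \<and> (v = [] \<or> P (last v) N)"
    unfolding successively_append_iff by auto
  moreover have "u = [] \<or> last u < N" "v = [] \<or> last v < N"
    using assms(4) last_in_set [of u] last_in_set [of v] by blast+
  then have "u = [] \<or> (P (last u) M \<longleftrightarrow> odd (last u))" "v = [] \<or> (P (last v) N \<longleftrightarrow> odd (last v))"
    using assms(3) by (auto simp: P_def)
  moreover have "P M (hd (v @ [N]))" using assms by (cases v) (auto simp: P_def)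
  moreover have "odd (last (u @ [M] @ v @ [N]))" using assms(2) by simp
  ultimately have "dumont_word (u @ [M] @ v @ [N]) \<longleftrightarrow> dumont_word u \<and> dumont_word v"
    unfolding word by blast
  then show ?thesis by simp
qed

text \<open>The end condition of \<open>u\<close> comes from the ascent to \<open>N\<close>, that of
  \<open>v\<close> from the end of the whole word. With \<open>v\<close> empty the word would end in
  the even letter \<open>M\<close>.\<close>

lemma dumont_word_append_adjacent:
  assumes "even M" "odd N" "N < M" "\<forall>x\<in>set u \<union> set v. x < N"
  shows "dumont_word (u @ N # M # v) \<longleftrightarrow> dumont_word u \<and> dumont_word v \<and> v \<noteq> []"
proof -
  define P where "P = (\<lambda>a b :: nat. if even a then b < a else a < b)"
  have word: "dumont_word xs \<longleftrightarrow> successively P xs \<and> (xs = [] \<or> odd (last xs))" for xs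
    by (auto simp: dumont_word_def P_def)
  have "successively P (u @ [N, M] @ v) \<longleftrightarrow> successively P u \<and> successively P v \<and>
      (u = [] \<or> P (last u) N) \<and> P N M \<and> (v = [] \<or> P M (hd v))"
    unfolding successively_append_iff by auto
  moreover have "u = [] \<or> last u < N" "v = [] \<or> hd v < N"
    using assms(4) last_in_set [of u] hd_in_set [of v] by blast+
  then have "u = [] \<or> (P (last u) N \<longleftrightarrow> odd (last u))" "v = [] \<or> P M (hd v)" "P N M"
    using assms(1-3) by (auto simp: P_def)
  moreover have "last (u @ [N, M] @ v) = (if v = [] then M else last v)" by simp
  ultimately have "dumont_word (u @ [N, M] @ v) \<longleftrightarrow> dumont_word u \<and> dumont_word v \<and> v \<noteq> []"
    unfolding word using assms(1) by auto
  then show ?thesis by simp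
qed

text \<open>The blocks are the intervals \<open>{1..r}\<close> and \<open>{r + 1..2 * m}\<close>. An
  odd \<open>r\<close> would make the least letter of \<open>u\<close> even, so
  \<open>r = 2 * j\<close> and lowering \<open>u\<close> by \<open>r\<close> preserves
  parity.\<close>

lemma split_above_below:
  assumes "distinct (u @ v)" "set (u @ v) = {1..2 * m}" "\<forall>x\<in>set u. \<forall>y\<in>set v. y < x" "dumont_word u"
  obtains j \<sigma> where "j \<le> m" "u = map (\<lambda>x. x + 2 * j) \<sigma>"
    "\<sigma> \<in> permutations_of_set {1..2 * (m - j)}" "v \<in> permutations_of_set {1..2 * j}"
proof -
  \<comment> \<open>Inserting 0 gives \<open>r = 0\<close> for an empty \<open>v\<close>.\<close>
  define r where "r = Max (insert 0 (set v))"
  have r: "r = 0 \<or> r \<in> set v" and le: "\<forall>x\<in>set v. x \<le> r"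
    using Max_in [of "insert 0 (set v)"] by (auto simp: r_def)
  have un: "set u \<union> set v = {1..2 * m}" and disj: "set u \<inter> set v = {}" using assms by auto
  have r2: "r \<le> 2 * m" using r un by auto
  have v: "set v = {1..r}"
  proof
    show "set v \<subseteq> {1..r}" using le un by auto
    show "{1..r} \<subseteq> set v"
    proof
      fix x assume x: "x \<in> {1..r}"
      then have rv: "r \<in> set v" using r by auto
      have "x \<in> set u \<union> set v" using x r2 un by auto
      moreover have "x \<notin> set u" using assms(3) rv x by force
      ultimately show "x \<in> set v" by simp
    qed
  qed
  have u: "set u = {r + 1..2 * m}"
  proof -
    have "set u = {1..2 * m} - set v" using un disj by blast
    then show ?thesis unfolding v by (intro set_eqI) (simp, linarith)
  qed
  have "even r"
  proof (rule ccontr)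
    assume "odd r"
    then have "r \<noteq> 2 * m" by auto
    then have "r + 1 \<in> set u" using r2 u by auto
    from dumont_word_even_descends [OF assms(4) this] \<open>odd r\<close> u show False by auto
  qed
  then obtain j where j: "r = 2 * j" by (auto elim: evenE)
  show ?thesis
  proof (rule that [of j "map (\<lambda>x. x - 2 * j) u"])
    show "j \<le> m" using r2 j by simp
    show "u = map (\<lambda>x. x + 2 * j) (map (\<lambda>x. x - 2 * j) u)"
      using u j by (auto intro!: map_idI [symmetric])
    show "v \<in> permutations_of_set {1..2 * j}"
      using v j assms(1) by (auto intro: permutations_of_setI)
    have "{2 * j + 1..2 * m} = (\<lambda>x. x + 2 * j) ` {1..2 * (m - j)}"
      using \<open>j \<le> m\<close> image_add_atLeastAtMost' [of "2 * j" 1 "2 * (m - j)"] by (simp add: diff_mult_distrib2)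
    then have "(\<lambda>x. x - 2 * j) ` {2 * j + 1..2 * m} = {1..2 * (m - j)}"
      by (simp only: image_image add_diff_cancel_right' image_ident)
    moreover have "inj_on (\<lambda>x. x - 2 * j) {2 * j + 1..2 * m}"
      by (auto simp: inj_on_def)
    ultimately show "map (\<lambda>x. x - 2 * j) u \<in> permutations_of_set {1..2 * (m - j)}"
      using u j assms(1) by (intro permutations_of_setI) (auto simp: distinct_map)
  qed
qed


section \<open>Patterns in the two block forms\<close>

text \<open>First \<open>N\<close> is removed, then \<open>M\<close>. Removing \<open>N\<close>
  needs two letters above the last one: 3 and 4 in 1342, and in \<open>l # t\<close> the letter
  \<open>l\<close> with a letter of \<open>t\<close>. For 1423 the order of the blocks takes
  over.\<close>

lemma contains_pattern_append_max_snoc: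
  assumes "\<forall>x\<in>set u. \<forall>y\<in>set v. y < x" "\<forall>x\<in>set u \<union> set v. x < N" "N < M"
  shows "contains_pattern (u @ M # v @ [N]) [1, 3, 4, 2] \<longleftrightarrow>
      contains_pattern u [1, 3, 4, 2] \<or> contains_pattern v [1, 3, 4, 2]"
    and "contains_pattern (u @ M # v @ [N]) [1, 4, 2, 3] \<longleftrightarrow>
      contains_pattern u [1, 4, 2, 3] \<or> contains_pattern v [1, 4, 2, 3]"
    and "\<not> decreasing_decomposable t \<Longrightarrow> t \<noteq> [] \<Longrightarrow> \<forall>x\<in>set t. x < l \<Longrightarrow> \<exists>y\<in>set t. last t < y \<Longrightarrow>
      contains_pattern (u @ M # v @ [N]) (l # t) \<longleftrightarrow> contains_pattern u (l # t) \<or> contains_pattern v t"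
proof -
  have lt: "\<forall>x\<in>set u \<union> set v. x < M" using assms(2,3) less_trans by blast
  have ltN: "\<forall>x\<in>set (u @ M # v). x < N \<or> x = M" using assms(2) by auto
  show "contains_pattern (u @ M # v @ [N]) [1, 3, 4, 2] \<longleftrightarrow>
      contains_pattern u [1, 3, 4, 2] \<or> contains_pattern v [1, 3, 4, 2]"
    using contains_pattern_snoc_second_max [of 3 "[1, 3, 4, 2]" 4 "u @ M # v" N M]
      contains_pattern_middle_max [OF not_decreasing_decomposable_Cons_min, of "[3, 4, 2]" 1 u v M]
      ltN lt assms(1) by simp
  show "contains_pattern (u @ M # v @ [N]) [1, 4, 2, 3] \<longleftrightarrow>
      contains_pattern u [1, 4, 2, 3] \<or> contains_pattern v [1, 4, 2, 3]"
    using contains_1423_snoc [OF assms]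
      contains_pattern_middle_max [OF not_decreasing_decomposable_Cons_min, of "[4, 2, 3]" 1 u v M]
      lt assms(1) by simp
  assume t: "\<not> decreasing_decomposable t" "t \<noteq> []" "\<forall>x\<in>set t. x < l" "\<exists>y\<in>set t. last t < y"
  then obtain y where "y \<in> set t" "last t < y" "y < l" by blast
  then show "contains_pattern (u @ M # v @ [N]) (l # t) \<longleftrightarrow> contains_pattern u (l # t) \<or> contains_pattern v t"
    using contains_pattern_snoc_second_max [of y "l # t" l "u @ M # v" N M]
      contains_pattern_middle_max_Cons [OF t(1-3) assms(1) lt] ltN t(2) by simp
qed

text \<open>Here \<open>N\<close> counts as the last letter of the upper block
  \<open>u @ [N]\<close>. Once \<open>M\<close> and \<open>v\<close> are split off, \<open>N\<close>
  is the maximum at the end of that block and can be removed.\<close>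

lemma contains_pattern_append_adjacent:
  assumes "\<forall>x\<in>set u. \<forall>y\<in>set v. y < x" "\<forall>x\<in>set u \<union> set v. x < N" "N < M"
  shows "contains_pattern (u @ N # M # v) [1, 3, 4, 2] \<longleftrightarrow>
      contains_pattern u [1, 3, 4, 2] \<or> contains_pattern v [1, 3, 4, 2]"
    and "contains_pattern (u @ N # M # v) [1, 4, 2, 3] \<longleftrightarrow>
      contains_pattern u [1, 4, 2, 3] \<or> contains_pattern v [1, 4, 2, 3]"
    and "\<not> decreasing_decomposable t \<Longrightarrow> t \<noteq> [] \<Longrightarrow> \<forall>x\<in>set t. x < l \<Longrightarrow>
      contains_pattern (u @ N # M # v) (l # t) \<longleftrightarrow> contains_pattern u (l # t) \<or> contains_pattern v t"
proof -
  have gt: "\<forall>x\<in>set (u @ [N]). \<forall>y\<in>set v. y < x" using assms(1,2) by auto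
  have lt: "\<forall>x\<in>set (u @ [N]) \<union> set v. x < M" using assms(2,3) less_trans by (simp add: ball_Un) blast
  have ltN: "\<forall>x\<in>set u. x < N" using assms(2) by auto
  show "contains_pattern (u @ N # M # v) [1, 3, 4, 2] \<longleftrightarrow>
      contains_pattern u [1, 3, 4, 2] \<or> contains_pattern v [1, 3, 4, 2]"
    using contains_pattern_snoc_max [of "[1, 3, 4, 2]" u N, OF _ ltN]
      contains_pattern_middle_max [OF not_decreasing_decomposable_Cons_min _ gt lt, of "[3, 4, 2]" 1]
    by simp
  show "contains_pattern (u @ N # M # v) [1, 4, 2, 3] \<longleftrightarrow>
      contains_pattern u [1, 4, 2, 3] \<or> contains_pattern v [1, 4, 2, 3]"
    using contains_pattern_snoc_max [of "[1, 4, 2, 3]" u N, OF _ ltN]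
      contains_pattern_middle_max [OF not_decreasing_decomposable_Cons_min _ gt lt, of "[4, 2, 3]" 1]
    by simp
  assume t: "\<not> decreasing_decomposable t" "t \<noteq> []" "\<forall>x\<in>set t. x < l"
  then have "last t < l" by simp
  then show "contains_pattern (u @ N # M # v) (l # t) \<longleftrightarrow> contains_pattern u (l # t) \<or> contains_pattern v t"
    using contains_pattern_snoc_max [of "l # t" u N, OF _ ltN] t(2)
      contains_pattern_middle_max_Cons [OF t gt lt] by simp
qed

section \<open>Cutting an avoiding permutation at its two largest letters\<close>

text \<open>Write \<open>N\<close> and \<open>M\<close> for the two largest letters. If
  \<open>x\<close> in \<open>u\<close> were below \<open>y\<close> in \<open>v\<close>, then
  \<open>x M y N\<close> would be an occurrence of 1423 in the first form and \<open>x N M y\<close>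
  one of 1342 in the second.\<close>

lemma dumont_avoiding_decompose:
  assumes "\<pi> \<in> permutations_of_set {1..2 * m + 2}" "dumont_word \<pi>"
    and "avoids_pattern \<pi> [1, 3, 4, 2]" "avoids_pattern \<pi> [1, 4, 2, 3]"
  obtains (top_last) u v where "\<pi> = u @ (2 * m + 2) # v @ [2 * m + 1]" "\<forall>x\<in>set u. \<forall>y\<in>set v. y < x"
    | (top_adjacent) u v where "\<pi> = u @ (2 * m + 1) # (2 * m + 2) # v" "\<forall>x\<in>set u. \<forall>y\<in>set v. y < x"
proof (cases "last \<pi> = 2 * m + 1")
  case set: True
  have \<pi>: "set \<pi> = {1..2 * m + 2}" "distinct \<pi>" using assms(1) by (auto dest: permutations_of_setD)
  then have "\<pi> \<noteq> []" by auto
  with set obtain w where w: "\<pi> = w @ [2 * m + 1]" by (metis append_butlast_last_id)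
  have "2 * m + 2 \<in> set \<pi>" unfolding \<pi> by simp
  then have "2 * m + 2 \<in> set w" using w by simp
  then obtain u v where uv: "w = u @ (2 * m + 2) # v" by (auto dest: split_list)
  have "y < x" if x: "x \<in> set u" and y: "y \<in> set v" for x y
  proof (rule ccontr)
    assume "\<not> y < x"
    moreover have "x \<in> set \<pi>" "y \<in> set \<pi>" using x y w uv by auto
    then have "x \<le> 2 * m + 2" "y \<le> 2 * m + 2" using \<pi>(1) by auto
    moreover have "x \<noteq> y" "y \<noteq> 2 * m + 1" "y \<noteq> 2 * m + 2" using \<pi>(2) x y w uv by auto
    ultimately have "order_iso [x, 2 * m + 2, y, 2 * m + 1] [1, 4, 2, 3]"
      by (auto simp: order_iso_def)
    moreover have "subseq ([x] @ [2 * m + 2] @ [y] @ [2 * m + 1]) (u @ [2 * m + 2] @ v @ [2 * m + 1])"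
      using x y by (intro list_emb_append_mono) (simp_all add: subseq_singleton_left)
    ultimately show False
      using assms(4) w uv unfolding contains_pattern_iff_subseq by auto
  qed
  then show ?thesis using top_last w uv by auto
next
  case last: False
  have \<pi>: "set \<pi> = {1..2 * m + 2}" "distinct \<pi>" using assms(1) by (auto dest: permutations_of_setD)
  have "2 * m + 1 \<in> set \<pi>" unfolding \<pi> by simp
  then obtain u w where w: "\<pi> = u @ (2 * m + 1) # w" by (auto dest: split_list)
  with last have "w \<noteq> []" by auto
  then obtain z v where v: "w = z # v" by (cases w) auto
  have "2 * m + 1 < z"
    using assms(2) unfolding w v by (simp add: dumont_word_def successively_append_iff)
  moreover have "z \<in> set \<pi>" using w v by simp
  ultimately have z: "z = 2 * m + 2" unfolding \<pi> by simp
  have "y < x" if x: "x \<in> set u" and y: "y \<in> set v" for x y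
  proof (rule ccontr)
    assume "\<not> y < x"
    moreover have "x \<in> set \<pi>" "y \<in> set \<pi>" using x y w v by auto
    then have "x \<le> 2 * m + 2" "y \<le> 2 * m + 2" using \<pi>(1) by auto
    moreover have "x \<noteq> y" "y \<noteq> 2 * m + 1" "y \<noteq> 2 * m + 2" using \<pi>(2) x y w v z by auto
    ultimately have "order_iso [x, 2 * m + 1, 2 * m + 2, y] [1, 3, 4, 2]"
      by (auto simp: order_iso_def)
    moreover have "subseq ([x] @ [2 * m + 1, 2 * m + 2] @ [y]) (u @ [2 * m + 1, 2 * m + 2] @ v)"
      using x y by (intro list_emb_append_mono) (simp_all add: subseq_singleton_left)
    ultimately show False
      using assms(3) w v z unfolding contains_pattern_iff_subseq by auto
  qed
  then show ?thesis using top_adjacent w v z by auto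
qed

section \<open>Gluing blocks and counting\<close>

abbreviation avoiders :: "nat list \<Rightarrow> nat \<Rightarrow> nat list set" where
  "avoiders \<tau> n \<equiv> dumont1_avoiding n {[1, 3, 4, 2], [1, 4, 2, 3], \<tau>}"

lemma avoiders_iff:
  "\<pi> \<in> avoiders \<tau> n \<longleftrightarrow> \<pi> \<in> permutations_of_set {1..2 * n} \<and> dumont_word \<pi> \<and>
     avoids_pattern \<pi> [1, 3, 4, 2] \<and> avoids_pattern \<pi> [1, 4, 2, 3] \<and> avoids_pattern \<pi> \<tau>"
  unfolding dumont1_avoiding_def dumont1_iff by auto

lemma finite_avoiders: "finite (avoiders \<tau> n)"
  unfolding dumont1_avoiding_def dumont1_def by simp

lemma avoiders_0: "\<tau> \<noteq> [] \<Longrightarrow> avoiders \<tau> 0 = {[]}"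
  by (rule set_eqI, unfold avoiders_iff) (auto simp: not_contains_pattern_Nil)

text \<open>In the intended use \<open>j\<close> is half the length of the lower block
  \<open>\<rho>\<close>; the upper block \<open>\<sigma>\<close> is stored on its own alphabet and
  lifted by \<open>2 * j\<close>.\<close>

definition glue_end :: "nat \<Rightarrow> nat \<times> nat list \<times> nat list \<Rightarrow> nat list" where
  "glue_end m = (\<lambda>(j, \<sigma>, \<rho>). map (\<lambda>x. x + 2 * j) \<sigma> @ (2 * m + 2) # \<rho> @ [2 * m + 1])"

definition glue_adjacent :: "nat \<Rightarrow> nat \<times> nat list \<times> nat list \<Rightarrow> nat list" where
  "glue_adjacent m = (\<lambda>(j, \<sigma>, \<rho>). map (\<lambda>x. x + 2 * j) \<sigma> @ (2 * m + 1) # (2 * m + 2) # \<rho>)"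

lemma shifted_blocks:
  assumes "j \<le> m" "\<sigma> \<in> permutations_of_set {1..2 * (m - j)}" "\<rho> \<in> permutations_of_set {1..2 * j}"
  defines "u \<equiv> map (\<lambda>x. x + 2 * j) \<sigma>"
  shows "set u = {2 * j + 1..2 * m}" "set \<rho> = {1..2 * j}" "distinct u" "distinct \<rho>"
    "length u = 2 * (m - j)"
proof -
  have "(\<lambda>x. x + 2 * j) ` {1..2 * (m - j)} = {1 + 2 * j..2 * (m - j) + 2 * j}"
    by (rule image_add_atLeastAtMost')
  also have "2 * (m - j) + 2 * j = 2 * m" using assms(1) by simp
  finally show "set u = {2 * j + 1..2 * m}"
    using permutations_of_setD(1) [OF assms(2)] by (simp add: u_def)
  show "set \<rho> = {1..2 * j}" "distinct u" "distinct \<rho>" "length u = 2 * (m - j)"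
    using assms(2,3) length_finite_permutations_of_set [OF assms(2)]
    by (auto dest: permutations_of_setD simp: u_def distinct_map)
qed


text \<open>For \<open>t\<close> a permutation of \<open>{1..l - 1}\<close>,
  \<open>last_not_max\<close> expresses that the last letter of \<open>l # t\<close> differs from
  \<open>l - 1\<close>.\<close>

locale pattern_context =
  fixes l :: nat and t :: "nat list"
  assumes indecomposable: "\<not> decreasing_decomposable t"
    and nonempty: "t \<noteq> []"
    and less: "\<forall>x\<in>set t. x < l"
    and last_not_max: "\<exists>y\<in>set t. last t < y"
begin

text \<open>Every condition splits over the two blocks: 1342 and 1423 are passed on to both, while
  \<open>l # t\<close> becomes \<open>t\<close> in the lower block, below \<open>M\<close>. One
  direction serves cutting, the other gluing.\<close>

lemma glue_end_avoiders_iff: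
  assumes "j \<le> m" "\<sigma> \<in> permutations_of_set {1..2 * (m - j)}" "\<rho> \<in> permutations_of_set {1..2 * j}"
  shows "glue_end m (j, \<sigma>, \<rho>) \<in> avoiders (l # t) (Suc m) \<longleftrightarrow>
    \<sigma> \<in> avoiders (l # t) (m - j) \<and> \<rho> \<in> avoiders t j"
proof -
  define u where "u = map (\<lambda>x. x + 2 * j) \<sigma>"
  note blocks = shifted_blocks [OF assms, folded u_def]
  have ord: "\<forall>x\<in>set u. \<forall>y\<in>set \<rho>. y < x" "\<forall>x\<in>set u \<union> set \<rho>. x < 2 * m + 1" "2 * m + 1 < 2 * m + 2"
    using blocks(1,2) assms(1) by auto
  have perm: "u @ (2 * m + 2) # \<rho> @ [2 * m + 1] \<in> permutations_of_set {1..2 * Suc m}"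
    using blocks assms(1) by (intro permutations_of_setI) auto
  have dumont: "dumont_word (u @ (2 * m + 2) # \<rho> @ [2 * m + 1]) \<longleftrightarrow> dumont_word u \<and> dumont_word \<rho>"
    using ord by (intro dumont_word_append_max_snoc) auto
  show ?thesis
    using perm dumont assms(2,3) contains_pattern_append_max_snoc [OF ord] indecomposable nonempty less last_not_max
    unfolding avoiders_iff glue_end_def by (auto simp: u_def)
qed

lemma glue_adjacent_avoiders_iff:
  assumes "j \<le> m" "\<sigma> \<in> permutations_of_set {1..2 * (m - j)}" "\<rho> \<in> permutations_of_set {1..2 * j}"
  shows "glue_adjacent m (j, \<sigma>, \<rho>) \<in> avoiders (l # t) (Suc m) \<longleftrightarrow>
    \<sigma> \<in> avoiders (l # t) (m - j) \<and> \<rho> \<in> avoiders t j \<and> 1 \<le> j"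
proof -
  define u where "u = map (\<lambda>x. x + 2 * j) \<sigma>"
  note blocks = shifted_blocks [OF assms, folded u_def]
  have ord: "\<forall>x\<in>set u. \<forall>y\<in>set \<rho>. y < x" "\<forall>x\<in>set u \<union> set \<rho>. x < 2 * m + 1" "2 * m + 1 < 2 * m + 2"
    using blocks(1,2) assms(1) by auto
  have perm: "u @ (2 * m + 1) # (2 * m + 2) # \<rho> \<in> permutations_of_set {1..2 * Suc m}"
    using blocks assms(1) by (intro permutations_of_setI) auto
  have dumont: "dumont_word (u @ (2 * m + 1) # (2 * m + 2) # \<rho>) \<longleftrightarrow>
      dumont_word u \<and> dumont_word \<rho> \<and> \<rho> \<noteq> []"
    using ord by (intro dumont_word_append_adjacent) auto
  \<comment> \<open>The lower block is nonempty exactly when \<open>j\<close> is positive, which is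
    why the adjacent form starts at \<open>j = 1\<close>.\<close>
  have "\<rho> = [] \<longleftrightarrow> {1..2 * j} = {}" using blocks(2) by (metis set_empty)
  then have "\<rho> \<noteq> [] \<longleftrightarrow> 1 \<le> j" by auto
  then show ?thesis
    using perm dumont assms(2,3) contains_pattern_append_adjacent [OF ord] indecomposable nonempty less
    unfolding avoiders_iff glue_adjacent_def by (auto simp: u_def)
qed

lemma avoiders_Suc:
  "avoiders (l # t) (Suc m) =
     glue_end m ` (SIGMA j:{..m}. avoiders (l # t) (m - j) \<times> avoiders t j) \<union>
     glue_adjacent m ` (SIGMA j:{1..m}. avoiders (l # t) (m - j) \<times> avoiders t j)"
    (is "_ = glue_end m ` ?E \<union> glue_adjacent m ` ?A")
proof
  show "avoiders (l # t) (Suc m) \<subseteq> glue_end m ` ?E \<union> glue_adjacent m ` ?A"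
  proof
    fix \<pi> assume \<pi>: "\<pi> \<in> avoiders (l # t) (Suc m)"
    then have *: "\<pi> \<in> permutations_of_set {1..2 * m + 2}" "dumont_word \<pi>"
      "avoids_pattern \<pi> [1, 3, 4, 2]" "avoids_pattern \<pi> [1, 4, 2, 3]"
      unfolding avoiders_iff by simp_all
    have set: "set \<pi> = {1..2 * m + 2}" and dist: "distinct \<pi>"
      using *(1) by (auto dest: permutations_of_setD)
    have diff: "{1..2 * m} = {1..2 * m + 2} - {2 * m + 1, 2 * m + 2}" by auto
    show "\<pi> \<in> glue_end m ` ?E \<union> glue_adjacent m ` ?A"
    proof (cases rule: dumont_avoiding_decompose [OF *])
      case (1 u v)
      have uv: "distinct (u @ v)" using dist unfolding 1 by auto
      have suv: "set (u @ v) = {1..2 * m}" using dist unfolding diff set [symmetric] 1 by auto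
      have "\<forall>x\<in>set u \<union> set v. x < 2 * m + 1" using suv by auto
      then have "dumont_word u"
        using *(2) unfolding 1 by (subst (asm) dumont_word_append_max_snoc) auto
      from split_above_below [OF uv suv 1(2) this] obtain j \<sigma> where j: "j \<le> m"
        "u = map (\<lambda>x. x + 2 * j) \<sigma>" "\<sigma> \<in> permutations_of_set {1..2 * (m - j)}"
        "v \<in> permutations_of_set {1..2 * j}" .
      have eq: "\<pi> = glue_end m (j, \<sigma>, v)" unfolding glue_end_def using 1 j by simp
      then have "(j, \<sigma>, v) \<in> ?E"
        using \<pi> j(1) glue_end_avoiders_iff [OF j(1,3,4)] by simp
      with eq show ?thesis by blast
    next
      case (2 u v)
      have uv: "distinct (u @ v)" using dist unfolding 2 by auto
      have suv: "set (u @ v) = {1..2 * m}" using dist unfolding diff set [symmetric] 2 by auto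
      have "\<forall>x\<in>set u \<union> set v. x < 2 * m + 1" using suv by auto
      then have "dumont_word u"
        using *(2) unfolding 2 by (subst (asm) dumont_word_append_adjacent) auto
      from split_above_below [OF uv suv 2(2) this] obtain j \<sigma> where j: "j \<le> m"
        "u = map (\<lambda>x. x + 2 * j) \<sigma>" "\<sigma> \<in> permutations_of_set {1..2 * (m - j)}"
        "v \<in> permutations_of_set {1..2 * j}" .
      have eq: "\<pi> = glue_adjacent m (j, \<sigma>, v)" unfolding glue_adjacent_def using 2 j by simp
      then have "(j, \<sigma>, v) \<in> ?A"
        using \<pi> j(1) glue_adjacent_avoiders_iff [OF j(1,3,4)] by simp
      with eq show ?thesis by blast
    qed
  qed
next
  show "glue_end m ` ?E \<union> glue_adjacent m ` ?A \<subseteq> avoiders (l # t) (Suc m)"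
  proof (intro Un_least image_subsetI)
    fix p assume p: "p \<in> ?E"
    then obtain j \<sigma> \<rho> where jsr: "p = (j, \<sigma>, \<rho>)" "j \<le> m" "\<sigma> \<in> avoiders (l # t) (m - j)" "\<rho> \<in> avoiders t j"
      by auto
    then show "glue_end m p \<in> avoiders (l # t) (Suc m)"
      using glue_end_avoiders_iff [of j m \<sigma> \<rho>] by (simp add: avoiders_iff del: One_nat_def)
  next
    fix p assume p: "p \<in> ?A"
    then obtain j \<sigma> \<rho> where jsr: "p = (j, \<sigma>, \<rho>)" "j \<le> m" "1 \<le> j" "\<sigma> \<in> avoiders (l # t) (m - j)" "\<rho> \<in> avoiders t j"
      by auto
    then show "glue_adjacent m p \<in> avoiders (l # t) (Suc m)"
      using glue_adjacent_avoiders_iff [of j m \<sigma> \<rho>] by (simp add: avoiders_iff del: One_nat_def)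
  qed
qed

lemma avoiders_blocks:
  assumes "(j, \<sigma>, \<rho>) \<in> (SIGMA j:{..m}. avoiders (l # t) (m - j) \<times> avoiders t j)"
  shows "j \<le> m" "set (map (\<lambda>x. x + 2 * j) \<sigma>) = {2 * j + 1..2 * m}" "set \<rho> = {1..2 * j}"
    "length \<sigma> = 2 * (m - j)"
proof -
  have jsr: "j \<le> m" "\<sigma> \<in> permutations_of_set {1..2 * (m - j)}" "\<rho> \<in> permutations_of_set {1..2 * j}"
    using assms unfolding mem_Sigma_iff avoiders_iff by auto
  from shifted_blocks [OF this] jsr(1) show "j \<le> m" "set (map (\<lambda>x. x + 2 * j) \<sigma>) = {2 * j + 1..2 * m}"
    "set \<rho> = {1..2 * j}" "length \<sigma> = 2 * (m - j)" by simp_all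
qed

lemma inj_on_glue:
  "inj_on (glue_end m) (SIGMA j:{..m}. avoiders (l # t) (m - j) \<times> avoiders t j)"
  "inj_on (glue_adjacent m) (SIGMA j:{..m}. avoiders (l # t) (m - j) \<times> avoiders t j)"
proof -
  let ?S = "SIGMA j:{..m}. avoiders (l # t) (m - j) \<times> avoiders t j"
  \<comment> \<open>The upper block alone determines \<open>j\<close>, through its length
    \<open>2 * (m - j)\<close>.\<close>
  have *: "j = j' \<and> \<sigma> = \<sigma>'"
    if "(j, \<sigma>, \<rho>) \<in> ?S" "(j', \<sigma>', \<rho>') \<in> ?S"
      and eq: "map (\<lambda>x. x + 2 * j) \<sigma> = map (\<lambda>x. x + 2 * j') \<sigma>'" for j \<sigma> \<rho> j' \<sigma>' \<rho>'
  proof -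
    have "2 * (m - j) = 2 * (m - j')"
      using avoiders_blocks(4) [OF that(1)] avoiders_blocks(4) [OF that(2)] map_eq_imp_length_eq [OF eq] by simp
    then have "j = j'"
      using avoiders_blocks(1) [OF that(1)] avoiders_blocks(1) [OF that(2)] by simp
    moreover from this have "\<sigma> = \<sigma>'" using eq inj_map_eq_map [of "\<lambda>x. x + 2 * j"] by simp
    ultimately show ?thesis by simp
  qed
  show "inj_on (glue_end m) ?S"
  proof (rule inj_onI)
    fix p q assume "p \<in> ?S" "q \<in> ?S" and eq: "glue_end m p = glue_end m q"
    moreover obtain j \<sigma> \<rho> j' \<sigma>' \<rho>' where pq: "p = (j, \<sigma>, \<rho>)" "q = (j', \<sigma>', \<rho>')"
      by (metis prod_cases3)
    ultimately have mem: "(j, \<sigma>, \<rho>) \<in> ?S" "(j', \<sigma>', \<rho>') \<in> ?S" by simp_all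
    \<comment> \<open>The maximum occurs nowhere else in the glued word, so equal words are cut at
      the same place. In the adjacent form \<open>2 * m + 1\<close> has this role.\<close>
    have notin: "2 * m + 2 \<notin> set (map (\<lambda>x. x + 2 * j) \<sigma>)" "2 * m + 2 \<notin> set (\<rho> @ [2 * m + 1])"
      using avoiders_blocks(1) [OF mem(1)] unfolding set_append avoiders_blocks(2,3) [OF mem(1)] by auto
    have "map (\<lambda>x. x + 2 * j) \<sigma> = map (\<lambda>x. x + 2 * j') \<sigma>' \<and> \<rho> @ [2 * m + 1] = \<rho>' @ [2 * m + 1]"
      using eq unfolding pq glue_end_def prod.case by (rule append_Cons_eq_iff [OF notin, THEN iffD1])
    then show "p = q" using * [OF mem] pq by simp
  qed
  show "inj_on (glue_adjacent m) ?S"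
  proof (rule inj_onI)
    fix p q assume "p \<in> ?S" "q \<in> ?S" and eq: "glue_adjacent m p = glue_adjacent m q"
    moreover obtain j \<sigma> \<rho> j' \<sigma>' \<rho>' where pq: "p = (j, \<sigma>, \<rho>)" "q = (j', \<sigma>', \<rho>')"
      by (metis prod_cases3)
    ultimately have mem: "(j, \<sigma>, \<rho>) \<in> ?S" "(j', \<sigma>', \<rho>') \<in> ?S" by simp_all
    have notin: "2 * m + 1 \<notin> set (map (\<lambda>x. x + 2 * j) \<sigma>)" "2 * m + 1 \<notin> set ((2 * m + 2) # \<rho>)"
      using avoiders_blocks(1) [OF mem(1)] unfolding list.set(2) avoiders_blocks(2,3) [OF mem(1)] by auto
    have "map (\<lambda>x. x + 2 * j) \<sigma> = map (\<lambda>x. x + 2 * j') \<sigma>' \<and>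
        (2 * m + 2) # \<rho> = (2 * m + 2) # \<rho>'"
      using eq unfolding pq glue_adjacent_def prod.case by (rule append_Cons_eq_iff [OF notin, THEN iffD1])
    then show "p = q" using * [OF mem] pq by simp
  qed
qed

text \<open>The last letter separates the two forms: it is \<open>2 * m + 1\<close> in the first and
  a letter of the nonempty lower block in the second.\<close>

lemma glue_disjoint:
  "glue_end m ` A \<inter>
     glue_adjacent m ` (SIGMA j:{1..m}. avoiders (l # t) (m - j) \<times> avoiders t j) = {}"
proof -
  have "glue_end m p \<noteq> glue_adjacent m (j, \<sigma>, \<rho>)"
    if "j \<in> {1..m}" "\<sigma> \<in> avoiders (l # t) (m - j)" "\<rho> \<in> avoiders t j" for p j \<sigma> \<rho>
  proof -
    have "(j, \<sigma>, \<rho>) \<in> (SIGMA j:{..m}. avoiders (l # t) (m - j) \<times> avoiders t j)" using that by simp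
    note \<rho> = avoiders_blocks(3) [OF this]
    then have "\<rho> \<noteq> []" using that(1) by auto
    then have "last (glue_adjacent m (j, \<sigma>, \<rho>)) \<in> {1..2 * j}"
      using last_in_set [of \<rho>] unfolding \<rho> by (simp add: glue_adjacent_def)
    then have "last (glue_adjacent m (j, \<sigma>, \<rho>)) \<noteq> 2 * m + 1" using that(1) by auto
    moreover have "last (glue_end m p) = 2 * m + 1" by (simp add: glue_end_def split_beta)
    ultimately show ?thesis by metis
  qed
  then show ?thesis by blast
qed

lemma card_avoiders_Suc:
  "card (avoiders (l # t) (Suc m)) + card (avoiders (l # t) m) =
     2 * (\<Sum>j\<le>m. card (avoiders (l # t) (m - j)) * card (avoiders t j))"
proof -
  let ?c = "\<lambda>j. card (avoiders (l # t) (m - j)) * card (avoiders t j)"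
  let ?S = "\<lambda>J. SIGMA j:J. avoiders (l # t) (m - j) \<times> avoiders t j"
  have fin: "finite (?S J)" and card: "card (?S J) = (\<Sum>j\<in>J. ?c j)" if "finite J" for J
    using that finite_avoiders by (auto simp: card_cartesian_product)
  have "?S {1..m} \<subseteq> ?S {..m}" by auto
  then have "inj_on (glue_adjacent m) (?S {1..m})" by (rule inj_on_subset [OF inj_on_glue(2)])
  then have "card (avoiders (l # t) (Suc m)) = (\<Sum>j\<le>m. ?c j) + (\<Sum>j\<in>{1..m}. ?c j)"
    unfolding avoiders_Suc
    by (simp only: card_Un_disjoint [OF _ _ glue_disjoint] fin finite_imageI card_image
        inj_on_glue(1) card finite_atMost finite_atLeastAtMost)
  \<comment> \<open>The term \<open>j = 0\<close> is missing from the adjacent form. Its value is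
    \<open>card (avoiders (l # t) m)\<close>, since the empty word is the only avoider of length 0;
    adding it completes the second sum.\<close>
  moreover have "(\<Sum>j\<le>m. ?c j) = card (avoiders (l # t) m) + (\<Sum>j\<in>{1..m}. ?c j)"
    using avoiders_0 [OF nonempty] by (simp add: atMost_atLeast0 sum.atLeast_Suc_atMost)
  ultimately show ?thesis by simp
qed

section \<open>The generating function identity\<close>

lemma A_gf_recurrence:
  includes fps_syntax
  shows "A_gf (l # t) * (1 + fps_X - 2 * fps_X * A_gf t) = 1"
proof (rule fps_ext)
  fix n
  let ?a = "A_gf (l # t)" and ?b = "A_gf t"
  \<comment> \<open>With \<open>fps_X\<close> in front of each product, the coefficient at
    \<open>Suc m\<close> is read off at \<open>m\<close>.\<close>
  have expand: "?a * (1 + fps_X - 2 * fps_X * ?b) = ?a + fps_X * ?a - 2 * (fps_X * (?b * ?a))"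
    by (simp add: algebra_simps)
  show "(?a * (1 + fps_X - 2 * fps_X * ?b)) $ n = 1 $ n"
  proof (cases n)
    case 0
    then show ?thesis
      using avoiders_0 [of "l # t"] by (simp add: A_gf_def)
  next
    case (Suc m)
    have "(\<Sum>j\<le>m. ?b $ j * ?a $ (m - j)) =
        of_nat (\<Sum>j\<le>m. card (avoiders (l # t) (m - j)) * card (avoiders t j))"
      by (simp add: A_gf_def mult.commute)
    moreover have "of_nat (card (avoiders (l # t) (Suc m)) + card (avoiders (l # t) m)) =
        (of_nat (2 * (\<Sum>j\<le>m. card (avoiders (l # t) (m - j)) * card (avoiders t j))) :: rat)"
      by (simp only: card_avoiders_Suc)
    moreover have "(?b * ?a) $ m = (\<Sum>j\<le>m. ?b $ j * ?a $ (m - j))"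
      by (simp add: fps_mult_nth atMost_atLeast0)
    moreover have "?a $ k = of_nat (card (avoiders (l # t) k))" for k
      by (simp add: A_gf_def)
    ultimately have "?a $ Suc m + ?a $ m = 2 * (?b * ?a) $ m"
      by simp
    moreover have "(2 * f) $ k = 2 * f $ k" for f :: "rat fps" and k
      unfolding mult_2 by (rule fps_add_nth)
    ultimately show ?thesis
      unfolding expand Suc by simp
  qed
qed

end

theorem theorem4p3:
  fixes l :: nat and \<tau>' \<tau> :: "nat list"
  assumes "l \<ge> 2"
    and "\<tau>' \<in> permutations_of_set {1..l - 1}"
    and "\<not> decreasing_decomposable \<tau>'"
    and "\<tau> = l # \<tau>'"
    and "last \<tau> \<noteq> l - 1"
  shows "A_gf \<tau> = 1 / (1 + fps_X - 2 * fps_X * A_gf \<tau>')"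
proof -
  have set: "set \<tau>' = {1..l - 1}" using assms(2) by (rule permutations_of_setD)
  then have ne: "\<tau>' \<noteq> []" using assms(1) by auto
  then have "last \<tau>' \<in> {1..l - 1}" using last_in_set set by metis
  moreover have "last \<tau>' \<noteq> l - 1" using assms(4,5) ne by simp
  ultimately have "last \<tau>' < l - 1" by auto
  moreover have "l - 1 \<in> set \<tau>'" using set assms(1) by auto
  ultimately have "\<exists>y\<in>set \<tau>'. last \<tau>' < y" by blast
  moreover have "\<forall>x\<in>set \<tau>'. x < l" using set assms(1) by auto
  ultimately interpret pattern_context l \<tau>'
    using assms(3) ne by unfold_locales
  \<comment> \<open>An inverse is determined by the product being 1.\<close>
  have "inverse (1 + fps_X - 2 * fps_X * A_gf \<tau>') = A_gf \<tau>"
    using A_gf_recurrence assms(4) by (intro fps_inverse_unique) (simp add: mult.commute)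
  then show ?thesis
    \<comment> \<open>The denominator has constant coefficient 1, so dividing by it is multiplying
      by its inverse.\<close>
    by (subst fps_divide_unit) simp_all
qed

end
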